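(* The smallest integer $k$ such that there exists a Septoku puzzle with $k$ seeds having a unique solution is $k=6$. That is: every set of at most five seeds is extended by either zero or at least two valid Septoku boards, and there exists a set of six seeds extended by exactly one valid Septoku board.
   Context: The Septoku board consists of 37 cells forming a regular hexagon of side 4 in a hexagonal grid, numbered row by row: $1$–$4$ (top row), $5$–$9$, $10$–$15$, $16$–$22$, $23$–$28$, $29$–$33$, $34$–$37$ (bottom row). The 21 "rows" of the board are: horizontal $\{1,2,3,4\}$, $\{5,\dots,9\}$, $\{10,\dots,15\}$, $\{16,\dots,22\}$, $\{23,\dots,28\}$, $\{29,\dots,33\}$, $\{34,\dots,37\}$; up-right $\{1,5,10,16\}$, $\{2,6,11,17,23\}$, $\{3,7,12,18,24,29\}$, $\{4,8,13,19,25,30,34\}$, $\{9,14,20,26,31,35\}$, $\{15,21,27,32,36\}$, $\{22,28,33,37\}$; down-right $\{4,9,15,22\}$, $\{3,8,14,21,28\}$, $\{2,7,13,20,27,33\}$, $\{1,6,12,19,26,32,37\}$, $\{5,11,18,25,31,36\}$, $\{10,17,24,30,35\}$, $\{16,23,29,34\}$. The seven "circles" are: $\{1,2,5,6,7,11,12\}$, $\{3,4,7,8,9,13,14\}$, $\{10,11,16,17,18,23,24\}$, $\{12,13,18,19,20,25,26\}$, $\{14,15,20,21,22,27,28\}$, $\{24,25,29,30,31,34,35\}$, $\{26,27,31,32,33,36,37\}$. A valid Septoku board is a map $s:\{1,\dots,37\}\to\{1,\dots,7\}$ such that the cells of each of the 21 rows receive pairwise distinct values and the seven cells of each circle receive pairwise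 distinct values. A Septoku puzzle with $k$ seeds is a partial map $p: S\to\{1,\dots,7\}$ with $S\subseteq\{1,\dots,37\}$, $|S|=k$; a solution is a valid board $s$ with $s|_S=p$, and the puzzle has a unique solution if exactly one such valid board exists. *)

theory Defs
  imports Main
begin

definition cells :: "nat set" where
  "cells = {1..37}"

definition symbols :: "nat set" where
  "symbols = {1..7}"

(* Horizontal, up-right and down-right lines, in this order. *)
definition rows :: "nat set set" where
  "rows =
    {{1,2,3,4}, {5,6,7,8,9}, {10,11,12,13,14,15}, {16,17,18,19,20,21,22},
     {23,24,25,26,27,28}, {29,30,31,32,33}, {34,35,36,37},
     {1,5,10,16}, {2,6,11,17,23}, {3,7,12,18,24,29}, {4,8,13,19,25,30,34},
     {9,14,20,26,31,35}, {15,21,27,32,36}, {22,28,33,37},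
     {4,9,15,22}, {3,8,14,21,28}, {2,7,13,20,27,33}, {1,6,12,19,26,32,37},
     {5,11,18,25,31,36}, {10,17,24,30,35}, {16,23,29,34}}"

definition circles :: "nat set set" where
  "circles =
    {{1,2,5,6,7,11,12}, {3,4,7,8,9,13,14}, {10,11,16,17,18,23,24},
     {12,13,18,19,20,25,26}, {14,15,20,21,22,27,28}, {24,25,29,30,31,34,35},
     {26,27,31,32,33,36,37}}"

(* Boards and puzzles are both partial maps on nat, so that "s extends p" is
   map inclusion and two boards are equal iff they agree on all 37 cells. *)

definition valid_board :: "(nat \<rightharpoonup> nat) \<Rightarrow> bool" where
  "valid_board s \<longleftrightarrow>
     dom s = cells \<and> ran s \<subseteq> symbols \<and>
     (\<forall>R\<in>rows. inj_on s R) \<and> (\<forall>C\<in>circles. inj_on s C)"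

definition puzzle :: "nat \<Rightarrow> (nat \<rightharpoonup> nat) \<Rightarrow> bool" where
  "puzzle k p \<longleftrightarrow> dom p \<subseteq> cells \<and> ran p \<subseteq> symbols \<and> card (dom p) = k"

definition solution :: "(nat \<rightharpoonup> nat) \<Rightarrow> (nat \<rightharpoonup> nat) \<Rightarrow> bool" where
  "solution p s \<longleftrightarrow> valid_board s \<and> p \<subseteq>\<^sub>m s"

definition unique_solution :: "(nat \<rightharpoonup> nat) \<Rightarrow> bool" where
  "unique_solution p \<longleftrightarrow> (\<exists>!s. solution p s)"

end

theory Submission
  imports Defs "HOL-Combinatorics.Transposition"
begin

text \<open>Five seeds leave two symbols unused. Both occur in every solution, since the middle row
  contains all seven symbols, so exchanging them turns a solution into a different one.
  For six seeds we exhibit a puzzle that is solved without branching: repeatedly some cell shares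
  rows or circles with six distinct known symbols and must carry the seventh.\<close>

lemma valid_board_inj_on:
  assumes "valid_board s" "L \<in> rows \<union> circles"
  shows "inj_on s L"
  using assms by (auto simp: valid_board_def)

lemma valid_board_value:
  assumes "valid_board s" "c \<in> cells"
  obtains v where "s c = Some v" "v \<in> symbols"
proof -
  obtain v where "s c = Some v"
    using assms by (metis valid_board_def domD)
  moreover from this have "v \<in> symbols"
    using assms(1) by (metis valid_board_def ranI subsetD)
  ultimately show ?thesis
    by (rule that)
qed

text \<open>The constraints only ask for distinct values on each line, so renaming the symbols by a
  permutation respects all of them.\<close>

lemma valid_board_comp_bij:
  assumes "valid_board s" "bij_betw f symbols symbols"
  shows "valid_board (map_option f \<circ> s)"
proof -
  have inj: "inj_on (map_option f \<circ> s) L" if "inj_on s L" for L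
  proof (rule comp_inj_on[OF that])
    \<comment> \<open>\<open>L\<close> is arbitrary here, so points outside \<open>cells\<close>,
      where \<open>s\<close> is \<open>None\<close>, have to be allowed.\<close>
    have "s ` L \<subseteq> insert None (Some ` symbols)"
      using assms(1) by (auto simp: valid_board_def ran_def subset_iff image_iff) (metis not_None_eq)
    moreover have "inj_on (map_option f) (insert None (Some ` symbols))"
      using assms(2) by (auto simp: bij_betw_def inj_on_def)
    ultimately show "inj_on (map_option f) (s ` L)"
      by (rule inj_on_subset[rotated])
  qed
  have "dom (map_option f \<circ> s) = dom s"
    by (auto simp: dom_def)
  moreover have "ran (map_option f \<circ> s) = f ` ran s"
    by (auto simp: ran_def)
  moreover have "f ` ran s \<subseteq> symbols"
    using assms unfolding valid_board_def bij_betw_def by (metis image_mono)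
  ultimately show ?thesis
    using assms(1) inj by (simp add: valid_board_def)
qed

text \<open>Pigeonhole: the middle row has seven cells with distinct values among seven
  symbols.\<close>

lemma symbols_subset_ran:
  assumes "valid_board s"
  shows "symbols \<subseteq> ran s"
proof -
  have "{16,17,18,19,20,21,22} \<in> rows" "{16,17,18,19,20,21,22} \<subseteq> cells"
      "card {16,17,18,19,20,21,22 :: nat} = 7"
    by (simp_all add: rows_def cells_def)
  then obtain L where L: "L \<in> rows" "L \<subseteq> cells" "card L = 7"
    by metis
  have "card (s ` L) = card (Some ` symbols)"
    using L valid_board_inj_on[OF assms] by (simp add: card_image symbols_def)
  moreover have "s ` L \<subseteq> Some ` symbols"
    using L(2) valid_board_value[OF assms] by (metis image_subsetI imageI subsetD)
  ultimately have "s ` L = Some ` symbols"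
    by (intro card_subset_eq) (simp_all add: symbols_def)
  thus ?thesis
    by (metis imageE imageI ranI subsetI)
qed

lemma few_seeds_second_solution:
  assumes "puzzle k p" "k \<le> 5" "solution p s"
  obtains t where "solution p t" "t \<noteq> s"
proof -
  have "finite (dom p)"
    using assms(1) by (auto simp: puzzle_def cells_def intro: finite_subset)
  \<comment> \<open>As an image of \<open>dom p\<close>, the set of symbols shown by the seeds is no
    larger than the set of seeds.\<close>
  moreover have "ran p = (\<lambda>c. the (p c)) ` dom p"
    by (force simp: ran_def dom_def image_iff)
  ultimately have "card (ran p) \<le> 5" "finite (ran p)"
    using assms(1,2) card_image_le[of "dom p" "\<lambda>c. the (p c)"] by (auto simp: puzzle_def)
  hence "2 \<le> card (symbols - ran p)"
    using diff_card_le_card_Diff[of "ran p" symbols] by (simp add: symbols_def)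
  then obtain A where "A \<subseteq> symbols - ran p" "card A = 2"
    by (rule obtain_subset_with_card_n)
  then obtain a b where ab: "a \<in> symbols - ran p" "b \<in> symbols - ran p" "a \<noteq> b"
    by (auto simp: card_2_iff)
  let ?t = "map_option (transpose a b) \<circ> s"
  have "p \<subseteq>\<^sub>m s" and valid: "valid_board s"
    using assms(3) by (auto simp: solution_def)
  have "p \<subseteq>\<^sub>m ?t"
  proof (rule map_le_def[THEN iffD2], rule ballI)
    fix c assume "c \<in> dom p"
    then obtain v where v: "p c = Some v" "v \<in> ran p"
      by (auto simp: ran_def)
    moreover have "s c = Some v"
      using \<open>p \<subseteq>\<^sub>m s\<close> v by (metis map_le_def domI)
    \<comment> \<open>The swap fixes \<open>v\<close>, since neither \<open>a\<close> nor
      \<open>b\<close> occurs in \<open>ran p\<close>.\<close>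
    ultimately show "p c = ?t c"
      using ab by (auto simp: transpose_def)
  qed
  moreover have "bij_betw (transpose a b) symbols symbols"
    using ab by (intro bij_betw_byWitness[where f' = "transpose a b"]) (auto simp: transpose_def)
  ultimately have "solution p ?t"
    using valid valid_board_comp_bij by (simp add: solution_def)
  \<comment> \<open>The swap moves the value of a cell carrying \<open>a\<close>, which makes the
    new solution different.\<close>
  moreover have "a \<in> ran s"
    using ab symbols_subset_ran[OF valid] by auto
  then obtain c where "s c = Some a"
    by (auto simp: ran_def)
  hence "?t c \<noteq> s c"
    using ab by simp
  ultimately show ?thesis
    using that by metis
qed

text \<open>The edges of the constraint graph: valid boards are its proper colourings with seven
  colours.\<close>

definition adjacent :: "nat \<Rightarrow> nat \<Rightarrow> bool" where
  "adjacent c d \<longleftrightarrow> c \<noteq> d \<and> (\<exists>L\<in>rows \<union> circles. c \<in> L \<and> d \<in> L)"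

lemma adjacent_neq:
  assumes "valid_board s" "adjacent c d"
  shows "s c \<noteq> s d"
  using assms valid_board_inj_on unfolding adjacent_def by (metis inj_onD)

text \<open>A checker for a chain of deductions. Each accepted step joins \<open>known\<close>, so
  later steps may rely on it.\<close>

fun forced :: "(nat \<times> nat) list \<Rightarrow> (nat \<times> nat) list \<Rightarrow> bool" where
  "forced known [] \<longleftrightarrow> True"
| "forced known ((c, v) # steps) \<longleftrightarrow>
     c \<in> cells \<and> (\<forall>w\<in>symbols. w \<noteq> v \<longrightarrow> (\<exists>(d, u)\<in>set known. u = w \<and> adjacent c d)) \<and>
     forced ((c, v) # known) steps"

text \<open>Induction along the deductions: any value other than \<open>v\<close> at
  \<open>c\<close> is already carried by a known neighbour of \<open>c\<close>, which an adjacent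
  cell may not repeat.\<close>

lemma forced_sound:
  assumes "valid_board s" "forced known steps" "\<forall>(c, v)\<in>set known. s c = Some v"
  shows "\<forall>(c, v)\<in>set (known @ steps). s c = Some v"
  using assms(2,3)
proof (induction known steps rule: forced.induct)
  case (2 known c v steps)
  obtain x where x: "s c = Some x" "x \<in> symbols"
    using 2 valid_board_value[OF assms(1)] by (metis forced.simps(2))
  have "x = v"
  proof (rule ccontr)
    assume "x \<noteq> v"
    then obtain d where "(d, x) \<in> set known" "adjacent c d"
      using 2 x by fastforce
    thus False
      using adjacent_neq[OF assms(1)] 2 x by fastforce
  qed
  thus ?case
    using 2 x by auto
qed simp

text \<open>Six different symbols are shown, so only 7 is absent and no swap of two absent symbols
  exists.\<close>

definition seeds :: "(nat \<times> nat) list" where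
  "seeds = [(1,1), (2,2), (7,3), (14,4), (18,5), (28,6)]"

text \<open>The other 31 cells, in an order of deduction. Cell 3 shares a line with every seed and
  hence carries 7; this in turn forces 6 at cell 12, and so on.\<close>

definition steps :: "(nat \<times> nat) list" where
  "steps =
    [(3,7), (12,6), (11,7), (5,4), (6,5), (13,1), (8,2), (9,6), (4,5), (20,7), (25,3),
     (19,4), (26,2), (27,5), (31,1), (24,4), (23,1), (29,2), (33,4), (35,5), (36,6),
     (34,7), (30,6), (17,3), (10,2), (15,3), (16,6), (21,1), (22,2), (32,7), (37,3)]"

lemma symbols_eq: "symbols = {1,2,3,4,5,6,7}"
  by (auto simp: symbols_def)

lemma forced_seeds_steps: "forced seeds steps"
  by (simp add: seeds_def steps_def cells_def symbols_eq adjacent_def rows_def circles_def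
      cong: conj_cong)

lemma fst_seeds_steps: "fst ` set (seeds @ steps) = cells"
  \<comment> \<open>The listed cells are 37 different ones among the 37 of the board.\<close>
  by (rule card_subset_eq) (simp_all add: seeds_def steps_def cells_def)

lemma map_of_seeds_steps: "\<forall>(c, v)\<in>set (seeds @ steps). map_of (seeds @ steps) c = Some v"
  by (simp add: seeds_def steps_def)

text \<open>With \<open>s\<close> a variable, the 37 assumed equations serve as rewrite rules and no
  lookup in the list is computed.\<close>

lemma inj_on_lines:
  assumes "\<forall>(c, v)\<in>set (seeds @ steps). s c = Some v"
  shows "\<forall>L\<in>rows \<union> circles. inj_on s L"
  using assms by (simp add: seeds_def steps_def rows_def circles_def)

lemma valid_board_seeds_steps: "valid_board (map_of (seeds @ steps))"
proof -
  have "dom (map_of (seeds @ steps)) = cells"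
    by (simp only: dom_map_of_conv_image_fst fst_seeds_steps)
  moreover have "ran (map_of (seeds @ steps)) \<subseteq> snd ` set (seeds @ steps)"
    by (force simp: ran_def dest: map_of_SomeD)
  moreover have "snd ` set (seeds @ steps) \<subseteq> symbols"
    by (simp add: seeds_def steps_def symbols_def)
  moreover have "\<forall>L\<in>rows \<union> circles. inj_on (map_of (seeds @ steps)) L"
    by (rule inj_on_lines[OF map_of_seeds_steps])
  ultimately show ?thesis
    unfolding valid_board_def by blast
qed

lemma puzzle_seeds: "puzzle 6 (map_of seeds)"
  by (simp add: puzzle_def seeds_def cells_def symbols_def)

lemma unique_solution_seeds: "unique_solution (map_of seeds)"
  unfolding unique_solution_def
proof (rule ex1I)
  show "solution (map_of seeds) (map_of (seeds @ steps))"
    \<comment> \<open>In \<open>map_of (seeds @ steps)\<close> the entries of \<open>seeds\<close>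
      take precedence, so this board extends the puzzle.\<close>
    using valid_board_seeds_steps by (auto simp: solution_def map_le_def map_add_dom_app_simps)
next
  fix s assume "solution (map_of seeds) s"
  hence s: "valid_board s" "map_of seeds \<subseteq>\<^sub>m s"
    by (auto simp: solution_def)
  have "map_of seeds c = Some v" if "(c, v) \<in> set seeds" for c v
    using that by (auto simp: seeds_def)
  hence "\<forall>(c, v)\<in>set seeds. s c = Some v"
    using s(2) by (auto simp del: map_of_eq_Some_iff) (metis map_le_def domI)
  hence agree: "\<forall>(c, v)\<in>set (seeds @ steps). s c = Some v"
    by (rule forced_sound[OF s(1) forced_seeds_steps])
  have "map_of (seeds @ steps) \<subseteq>\<^sub>m s"
    unfolding map_le_def
  proof
    fix c assume "c \<in> dom (map_of (seeds @ steps))"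
    then obtain v where "map_of (seeds @ steps) c = Some v"
      by blast
    moreover from this have "(c, v) \<in> set (seeds @ steps)"
      by (rule map_of_SomeD)
    hence "s c = Some v"
      using bspec[OF agree] by fast
    ultimately show "map_of (seeds @ steps) c = s c"
      by (simp only:)
  qed
  \<comment> \<open>Both boards are defined exactly on \<open>cells\<close>, which turns the
    inclusion of maps into an equality.\<close>
  moreover have "dom s = dom (map_of (seeds @ steps))"
    using s(1) valid_board_seeds_steps by (simp add: valid_board_def)
  ultimately show "s = map_of (seeds @ steps)"
    by (metis map_le_antisym map_le_def)
qed

theorem theorem6:
  shows "(LEAST k. \<exists>p. puzzle k p \<and> unique_solution p) = 6 \<and>
    (\<forall>k p. k \<le> 5 \<and> puzzle k p \<longrightarrow>
       (\<nexists>s. solution p s) \<or> (\<exists>s t. solution p s \<and> solution p t \<and> s \<noteq> t)) \<and>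
    (\<exists>p. puzzle 6 p \<and> unique_solution p)"
proof (intro conjI)
  show few: "\<forall>k p. k \<le> 5 \<and> puzzle k p \<longrightarrow>
      (\<nexists>s. solution p s) \<or> (\<exists>s t. solution p s \<and> solution p t \<and> s \<noteq> t)"
    by (metis few_seeds_second_solution)
  show six: "\<exists>p. puzzle 6 p \<and> unique_solution p"
    using puzzle_seeds unique_solution_seeds by blast
  show "(LEAST k. \<exists>p. puzzle k p \<and> unique_solution p) = 6"
  proof (rule Least_equality)
    show "\<exists>p. puzzle 6 p \<and> unique_solution p"
      by (rule six)
  next
    fix k :: nat assume "\<exists>p. puzzle k p \<and> unique_solution p"
    \<comment> \<open>Either alternative in \<open>few\<close>, no solution or two of them,
      contradicts uniqueness.\<close>
    hence "\<not> k \<le> 5"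
      using few unfolding unique_solution_def by metis
    thus "6 \<le> k"
      by simp
  qed
qed

end
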